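(* Let $S$ be a symmetry group in dimension $d$, let $(G,p)$ be a framework in $\mathscr{R}_{(G,S)}$ in $\mathbb{E}^d$ with $n$ joints, and let $q$ be a configuration of $n+1$ points (including the origin, as the position of the cone joint $o$) in $\mathbb{E}^{d+1}$ such that $(G*o,q)\in\mathscr{R}_{(G*o,S^* )}$ and such that the projection $\pi(q)$ from the origin onto the hyperplane $x_{d+1}=1$, then projected back to $\mathbb{E}^d$, is equal to $p\in\mathbb{E}^{dn}$. Then: (i) the space of $S$-symmetric infinitesimal motions of $(G,p)$ in $\mathbb{E}^{d}$ is isomorphic to the space of $S^{*}$-symmetric infinitesimal motions of $(G*o,q)$ in $\mathbb{E}^{d+1}$ with the cone joint of $(G*o,q)$ fixed at the origin; (ii) the space of $S$-symmetric trivial infinitesimal motions of $(G,p)$ in $\mathbb{E}^{d}$ is isomorphic to the space of $S^{*}$-symmetric trivial infinitesimal motions of $(G*o,q)$ in $\mathbb{E}^{d+1}$ with the cone joint of $(G*o,q)$ fixed at the origin; (iii) $(G,p)$ has a non-trivial $S$-symmetric infinitesimal motion in $\mathbb{E}^{d}$ if and only if $(G*o,q)$ has a non-trivial $S^{*}$-symmetric infinitesimal motion in $\mathbb{E}^{d+1}$; (iv) the space of $S$-symmetric self-stresses of $(G,p)$ is isomorphic to the space of $S^{*}$-symmetric self-stresses of $(G*o,q)$.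
   Context: A framework $(G,p)$ in $\mathbb{E}^d$ is a finite simple graph $G$ with vertex set $V(G)=\{1,\dots,n\}$ and edge set $E(G)$, together with an injective map $p:V(G)\to\mathbb{E}^d$; $p_i=p(i)$. An infinitesimal motion of $(G,p)$ is a map $u:V(G)\to\mathbb{E}^d$ with $(p_i-p_j)\cdot(u_i-u_j)=0$ for all $\{i,j\}\in E(G)$. It is trivial if $u_i=Ap_i+t$ for all $i$, for some skew-symmetric matrix $A$ and vector $t$; otherwise non-trivial. A self-stress is a function $\omega:E(G)\to\mathbb{R}$ with $\sum_{j:\{i,j\}\in E(G)}\omega_{ij}(p_i-p_j)=0$ for every vertex $i$. A symmetry group in dimension $d$ is a subgroup $S$ of the orthogonal group $O(\mathbb{E}^d)$. $\mathscr{R}_{(G,S)}$ is the set of frameworks $(G,p)$ in $\mathbb{E}^d$ for which there is a map $\Phi:S\to\mathrm{Aut}(G)$ with $x(p_i)=p_{\Phi(x)(i)}$ for all $i\in V(G)$, $x\in S$ (since $p$ is injective, $\Phi$ is unique and a homomorphism); write $x(i)$ for $\Phi(x)(i)$. An infinitesimal motion $u$ is $S$-symmetric if $x(u_i)=u_{x(i)}$ for all $i$ and all $x\in S$. A self-stress is $S$-symmetric if it is constant on the orbits of edges under $S$. For $x\in S$ with matrix $M_x$, $x^*$ is the orthogonal transformation of $\mathbb{E}^{d+1}$ with matrix $\begin{pmatrix}M_x&0\\0&1\end{pmatrix}$, and $S^*=\{x^*:x\in S\}$. The cone graph $G*o$ is $G$ with a new vertex $o$ joined to all vertices of $G$. In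 $(G*o,q)$ the cone joint $o$ is at the origin. The condition $\pi(q)=p$ means that for each $i\in V(G)$ there is a scalar $\alpha_i\neq0$ with $q_i=\alpha_i(p_i,1)$. The notions of infinitesimal motion, self-stress, $\mathscr{R}_{(G*o,S^* )}$ and symmetry apply to $(G*o,q)$ in $\mathbb{E}^{d+1}$ with group $S^*$. "With the cone joint fixed at the origin" means only motions with $u_o=0$ are considered. *)

theory Defs
  imports "HOL-Analysis.Analysis" "HOL-Algebra.Group"
begin

text \<open>
  Euclidean d-space is \<open>real ^ 'd\<close>; the vertex set of a graph is a finite type \<open>'v\<close>, a graph on it
  is given by its set of edges, and a configuration or a velocity assignment is a vector in
  \<open>(real ^ 'd) ^ 'v\<close>, whose entry at \<open>i\<close> belongs to the vertex \<open>i\<close>. Coning enlarges both index types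
  by \<open>None\<close>: it is the cone joint among the vertices, and the last coordinate of the
  ambient space \<open>real ^ ('d option)\<close>.
\<close>

definition simple_graph :: "'v::finite set set \<Rightarrow> bool" where
  "simple_graph E \<longleftrightarrow> (\<forall>e\<in>E. card e = 2)"

definition graph_aut :: "'v::finite set set \<Rightarrow> ('v \<Rightarrow> 'v) set" where
  "graph_aut E = {f. bij f \<and> (\<forall>i j. {i, j} \<in> E \<longleftrightarrow> {f i, f j} \<in> E)}"

definition cone_graph :: "'v::finite set set \<Rightarrow> 'v option set set" where
  "cone_graph E = (\<lambda>e. Some ` e) ` E \<union> {{None, Some i} | i. True}"

definition framework :: "'v::finite set set \<Rightarrow> (real ^ 'd) ^ 'v \<Rightarrow> bool" where
  "framework E p \<longleftrightarrow> simple_graph E \<and> inj (\<lambda>i. p $ i)"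

definition infinitesimal_motions ::
    "'v::finite set set \<Rightarrow> (real ^ 'd) ^ 'v \<Rightarrow> ((real ^ 'd) ^ 'v) set" where
  "infinitesimal_motions E p =
     {u. \<forall>i j. {i, j} \<in> E \<longrightarrow> (p $ i - p $ j) \<bullet> (u $ i - u $ j) = 0}"

definition trivial_motions ::
    "'v::finite set set \<Rightarrow> (real ^ 'd) ^ 'v \<Rightarrow> ((real ^ 'd) ^ 'v) set" where
  "trivial_motions E p =
     {u \<in> infinitesimal_motions E p.
        \<exists>(A :: real ^ 'd ^ 'd) t. transpose A = - A \<and> (\<forall>i. u $ i = A *v (p $ i) + t)}"

text \<open>
  A function on the edge set is encoded as a vector indexed by all vertex sets that vanishes
  outside \<open>E\<close>.
\<close>

definition self_stresses ::
    "'v::finite set set \<Rightarrow> (real ^ 'd) ^ 'v \<Rightarrow> (real ^ ('v set)) set" where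
  "self_stresses E p =
     {\<omega>. (\<forall>e. e \<notin> E \<longrightarrow> \<omega> $ e = 0) \<and>
         (\<forall>i. (\<Sum>j | {i, j} \<in> E. (\<omega> $ {i, j}) *\<^sub>R (p $ i - p $ j)) = 0)}"

definition orthogonal_group :: "(real ^ 'd ^ 'd) monoid" where
  "orthogonal_group = \<lparr>carrier = {M. orthogonal_matrix M}, mult = (**), one = mat 1\<rparr>"

definition symmetry_group :: "(real ^ 'd ^ 'd) set \<Rightarrow> bool" where
  "symmetry_group S \<longleftrightarrow> subgroup S orthogonal_group"

definition symmetry_map ::
    "'v::finite set set \<Rightarrow> (real ^ 'd ^ 'd) set \<Rightarrow> (real ^ 'd) ^ 'v
     \<Rightarrow> (real ^ 'd ^ 'd \<Rightarrow> 'v \<Rightarrow> 'v) \<Rightarrow> bool" where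
  "symmetry_map E S p \<Phi> \<longleftrightarrow>
     (\<forall>x\<in>S. \<Phi> x \<in> graph_aut E) \<and> (\<forall>x\<in>S. \<forall>i. x *v (p $ i) = p $ (\<Phi> x i))"

text \<open>The set of configurations \<open>p\<close> for which \<open>(G, p)\<close> lies in \<open>\<R>(G, S)\<close>.\<close>

definition symmetric_frameworks ::
    "'v::finite set set \<Rightarrow> (real ^ 'd ^ 'd) set \<Rightarrow> ((real ^ 'd) ^ 'v) set" where
  "symmetric_frameworks E S = {p. framework E p \<and> (\<exists>\<Phi>. symmetry_map E S p \<Phi>)}"

text \<open>
  For a framework in \<open>\<R>(G, S)\<close> the map \<open>\<Phi>\<close> is uniquely determined on \<open>S\<close>, because \<open>p\<close> is injective;
  it is arbitrary outside \<open>S\<close>, where it is never used.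
\<close>

definition vertex_action ::
    "'v::finite set set \<Rightarrow> (real ^ 'd ^ 'd) set \<Rightarrow> (real ^ 'd) ^ 'v
     \<Rightarrow> real ^ 'd ^ 'd \<Rightarrow> 'v \<Rightarrow> 'v" where
  "vertex_action E S p = (SOME \<Phi>. symmetry_map E S p \<Phi>)"

definition edge_orbit ::
    "'v::finite set set \<Rightarrow> (real ^ 'd ^ 'd) set \<Rightarrow> (real ^ 'd) ^ 'v \<Rightarrow> 'v set \<Rightarrow> 'v set set" where
  "edge_orbit E S p e = {vertex_action E S p x ` e | x. x \<in> S}"

definition symmetric_motions ::
    "'v::finite set set \<Rightarrow> (real ^ 'd ^ 'd) set \<Rightarrow> (real ^ 'd) ^ 'v \<Rightarrow> ((real ^ 'd) ^ 'v) set" where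
  "symmetric_motions E S p =
     {u \<in> infinitesimal_motions E p.
        \<forall>x\<in>S. \<forall>i. x *v (u $ i) = u $ (vertex_action E S p x i)}"

definition symmetric_trivial_motions ::
    "'v::finite set set \<Rightarrow> (real ^ 'd ^ 'd) set \<Rightarrow> (real ^ 'd) ^ 'v \<Rightarrow> ((real ^ 'd) ^ 'v) set" where
  "symmetric_trivial_motions E S p = symmetric_motions E S p \<inter> trivial_motions E p"

definition symmetric_self_stresses ::
    "'v::finite set set \<Rightarrow> (real ^ 'd ^ 'd) set \<Rightarrow> (real ^ 'd) ^ 'v \<Rightarrow> (real ^ ('v set)) set" where
  "symmetric_self_stresses E S p =
     {\<omega> \<in> self_stresses E p. \<forall>e\<in>E. (\<lambda>f. \<omega> $ f) constant_on edge_orbit E S p e}"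

text \<open>The block matrix with diagonal blocks \<open>M\<close> and 1.\<close>

definition star_mat :: "real ^ 'd ^ 'd \<Rightarrow> real ^ ('d option) ^ ('d option)" where
  "star_mat M = (\<chi> i j. case (i, j) of
       (Some a, Some b) \<Rightarrow> M $ a $ b
     | (None, None) \<Rightarrow> 1
     | _ \<Rightarrow> 0)"

text \<open>The point \<open>(v, 1)\<close>.\<close>

definition cone_lift :: "real ^ 'd \<Rightarrow> real ^ ('d option)" where
  "cone_lift v = (\<chi> k. case k of Some a \<Rightarrow> v $ a | None \<Rightarrow> 1)"

text \<open>The condition \<open>\<pi>(q) = p\<close>; it does not constrain the position of the cone joint.\<close>

definition projects_to ::
    "(real ^ ('d option)) ^ ('v option) \<Rightarrow> (real ^ 'd) ^ ('v::finite) \<Rightarrow> bool" where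
  "projects_to q p \<longleftrightarrow> (\<forall>i. \<exists>\<alpha>. \<alpha> \<noteq> 0 \<and> q $ Some i = \<alpha> *\<^sub>R cone_lift (p $ i))"

definition cone_joint_fixed :: "((real ^ ('d::finite option)) ^ ('v::finite option)) set" where
  "cone_joint_fixed = {u. u $ None = 0}"

text \<open>
  Isomorphism of linear subspaces. Asking for a linear map on the whole ambient space is no
  restriction, since linear maps extend from subspaces.
\<close>

definition isomorphic_subspaces ::
    "'a::real_vector set \<Rightarrow> 'b::real_vector set \<Rightarrow> bool" where
  "isomorphic_subspaces U W \<longleftrightarrow>
     subspace U \<and> subspace W \<and> (\<exists>f. linear f \<and> bij_betw f U W)"

end

theory Submission imports Defs begin

text \<open>
  Write \<open>q\<^sub>i = \<alpha>\<^sub>i (p\<^sub>i, 1)\<close> with \<open>\<alpha>\<^sub>i \<noteq> 0\<close>. Each element \<open>x\<^sup>*\<close> of the extended group fixes the origin and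
  preserves the last coordinate, so its vertex action fixes the cone joint and sends \<open>i\<close> to \<open>x(i)\<close>,
  and \<open>\<alpha>\<close> is constant on vertex orbits (lemmas \<open>cone_act_None\<close>, \<open>cone_act_Some\<close>, \<open>scale_act\<close>).
  Any construction that is natural in \<open>p\<close> and \<open>\<alpha>\<close> therefore preserves symmetry.

  For motions, send \<open>u\<close> to \<open>U\<^sub>o = 0\<close>, \<open>U\<^sub>i = \<alpha>\<^sub>i (u\<^sub>i, - u\<^sub>i \<bullet> p\<^sub>i)\<close>. The spokes require \<open>q\<^sub>i \<bullet> U\<^sub>i = 0\<close>, which
  is what determines the last coordinate of \<open>U\<^sub>i\<close>; given this, a base edge contributes
  \<open>(q\<^sub>i - q\<^sub>j) \<bullet> (U\<^sub>i - U\<^sub>j) = \<alpha>\<^sub>i \<alpha>\<^sub>j (p\<^sub>i - p\<^sub>j) \<bullet> (u\<^sub>i - u\<^sub>j)\<close> (\<open>lift_motion_edge\<close>). Thus \<open>u\<close> is a motion if and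
  only if \<open>U\<close> is, and all motions fixing the cone joint arise in this way. The trivial motion
  \<open>A p\<^sub>i + t\<close> corresponds to \<open>B q\<^sub>i\<close>, where \<open>B\<close> is the skew-symmetric matrix with rows \<open>(A, t)\<close> and
  \<open>(- t\<^sup>T, 0)\<close>; every skew-symmetric matrix of the larger size has this form
  (\<open>lift_motion_trivial_iff\<close>). For the equivalence on nontrivial motions, the cone joint is brought
  to rest by subtracting a translation, which is itself a symmetric trivial motion.

  For self-stresses, put \<open>W\<^sub>i\<^sub>j = \<omega>\<^sub>i\<^sub>j / (\<alpha>\<^sub>i \<alpha>\<^sub>j)\<close> on base edges. The equilibrium at \<open>i\<close> splits into its last
  coordinate, which determines the coefficient of the spoke at \<open>i\<close>, and a remainder proportional to
  the equilibrium of \<open>\<omega>\<close> at \<open>i\<close> (\<open>cone_equilibrium_iff\<close>). The equilibrium at the cone joint follows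
  by summing over the other vertices (\<open>cone_joint_equilibrium\<close>).
\<close>

section \<open>Vectors with one additional coordinate\<close>

text \<open>The vector \<open>(v, c)\<close>; the added coordinate has index \<open>None\<close>.\<close>

definition append_coord :: "real ^ 'd \<Rightarrow> real \<Rightarrow> real ^ ('d option)" where
  "append_coord v c = (\<chi> k. case k of Some a \<Rightarrow> v $ a | None \<Rightarrow> c)"

text \<open>The projection \<open>(v, c) \<mapsto> v\<close>.\<close>

definition drop_coord :: "real ^ ('d option) \<Rightarrow> real ^ 'd" where
  "drop_coord y = (\<chi> a. y $ Some a)"

lemma append_coord_nth [simp]:
  "append_coord v c $ None = c" "append_coord v c $ Some a = v $ a"
  by (simp_all add: append_coord_def)

lemma drop_coord_nth [simp]: "drop_coord y $ a = y $ Some a"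
  by (simp add: drop_coord_def)

lemma vec_option_eq_iff:
  fixes y z :: "'a ^ ('d::finite option)"
  shows "y = z \<longleftrightarrow> y $ None = z $ None \<and> (\<forall>a. y $ Some a = z $ Some a)"
  by (simp add: vec_eq_iff split_option_all)

lemma sum_UNIV_option:
  fixes f :: "'a::finite option \<Rightarrow> 'b::comm_monoid_add"
  shows "(\<Sum>k\<in>UNIV. f k) = f None + (\<Sum>a\<in>UNIV. f (Some a))"
  by (simp add: UNIV_option_conv sum.reindex)

lemma drop_append_coord [simp]: "drop_coord (append_coord v c) = v"
  by (simp add: vec_eq_iff)

lemma append_drop_coord [simp]: "append_coord (drop_coord y) (y $ None) = y"
  by (simp add: vec_option_eq_iff)

lemma append_coord_eq_iff [simp]: "append_coord v c = append_coord w d \<longleftrightarrow> v = w \<and> c = d"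
  by (auto simp: vec_option_eq_iff vec_eq_iff)

lemma append_coord_0 [simp]: "append_coord 0 0 = 0"
  by (simp add: vec_option_eq_iff)

lemma append_coord_add: "append_coord v c + append_coord w d = append_coord (v + w) (c + d)"
  by (simp add: vec_option_eq_iff)

lemma append_coord_diff: "append_coord v c - append_coord w d = append_coord (v - w) (c - d)"
  by (simp add: vec_option_eq_iff)

lemma append_coord_scaleR: "r *\<^sub>R append_coord v c = append_coord (r *\<^sub>R v) (r * c)"
  by (simp add: vec_option_eq_iff)

lemma inner_append_coord:
  "append_coord v c \<bullet> append_coord w d = v \<bullet> w + c * d"
  by (simp add: inner_vec_def sum_UNIV_option)

lemma cone_lift_eq_append_coord: "cone_lift v = append_coord v 1"
  by (simp add: cone_lift_def append_coord_def)

lemma star_mat_mult_append_coord: "star_mat M *v append_coord v c = append_coord (M *v v) c"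
  by (simp add: vec_option_eq_iff matrix_vector_mult_def star_mat_def sum_UNIV_option)

lemma star_mat_1: "star_mat (mat 1) = mat 1"
  by (auto simp: vec_eq_iff star_mat_def mat_def split: option.splits)

section \<open>Skew-symmetric and orthogonal matrices\<close>

lemma inner_skew_self_eq_0:
  fixes A :: "real ^ 'd ^ 'd"
  assumes "transpose A = - A"
  shows "(A *v v) \<bullet> v = 0"
proof -
  have "(A *v v) \<bullet> v = v \<bullet> (A *v v)"
    by (rule inner_commute)
  also have "\<dots> = (transpose A *v v) \<bullet> v"
    by (simp add: dot_lmul_matrix transpose_matrix_vector)
  also have "\<dots> = - ((A *v v) \<bullet> v)"
    using matrix_vector_mult_diff_rdistrib[of 0 A v] by (simp add: assms)
  finally show ?thesis by simp
qed

lemma inner_orthogonal_matrix: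
  fixes M :: "real ^ 'd ^ 'd"
  assumes "orthogonal_matrix M"
  shows "(M *v v) \<bullet> (M *v w) = v \<bullet> w"
  using assms orthogonal_transformation_matrix[of "(*v) M"] matrix_of_matrix_vector_mul[of M]
  by (simp add: orthogonal_transformation_def)

text \<open>The block matrix with rows \<open>(A, t)\<close> and \<open>(- t\<^sup>T, 0)\<close>.\<close>

definition skew_block :: "real ^ 'd ^ 'd \<Rightarrow> real ^ 'd \<Rightarrow> real ^ ('d option) ^ ('d option)" where
  "skew_block A t = (\<chi> k l. case (k, l) of
       (Some a, Some b) \<Rightarrow> A $ a $ b
     | (Some a, None) \<Rightarrow> t $ a
     | (None, Some b) \<Rightarrow> - t $ b
     | (None, None) \<Rightarrow> 0)"

lemma skew_block_mult_append_coord: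
  "skew_block A t *v append_coord v c = append_coord (A *v v + c *\<^sub>R t) (- (t \<bullet> v))"
  by (simp add: vec_option_eq_iff matrix_vector_mult_def skew_block_def sum_UNIV_option
      inner_vec_def sum_negf algebra_simps)

lemma transpose_eq_uminus_iff:
  fixes A :: "real ^ 'd ^ 'd"
  shows "transpose A = - A \<longleftrightarrow> (\<forall>k l. A $ l $ k = - (A $ k $ l))"
  by (simp add: vec_eq_iff transpose_def)

lemma transpose_skew_block:
  assumes "transpose A = - A"
  shows "transpose (skew_block A t) = - skew_block A t"
proof -
  have A: "A $ b $ a = - (A $ a $ b)" for a b
    using assms unfolding transpose_eq_uminus_iff by blast
  show ?thesis
    by (simp add: transpose_eq_uminus_iff skew_block_def split_option_all) (intro allI A)
qed

lemma skew_matrix_eq_skew_block: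
  fixes B :: "real ^ ('d::finite option) ^ ('d option)"
  assumes "transpose B = - B"
  obtains A t where "transpose A = - A" "B = skew_block A t"
proof
  have B: "B $ l $ k = - (B $ k $ l)" for k l
    using assms unfolding transpose_eq_uminus_iff by blast
  let ?A = "\<chi> a b. B $ Some a $ Some b"
  let ?t = "\<chi> a. B $ Some a $ None"
  show "transpose ?A = - ?A"
    unfolding transpose_eq_uminus_iff vec_lambda_beta by (intro allI B)
  have "B $ None $ None = 0"
    using B[of None None] by simp
  moreover have "B $ None $ Some a = - (B $ Some a $ None)" for a
    by (rule B)
  ultimately show "B = skew_block ?A ?t"
    by (simp add: vec_eq_iff skew_block_def split_option_all)
qed

section \<open>Linear isomorphisms between subspaces\<close>

lemma isomorphic_subspacesI:
  assumes "subspace U" "subspace W" "linear f"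
    and "\<And>u. u \<in> U \<Longrightarrow> f u \<in> W" "\<And>w. w \<in> W \<Longrightarrow> g w \<in> U"
    and "\<And>u. u \<in> U \<Longrightarrow> g (f u) = u" "\<And>w. w \<in> W \<Longrightarrow> f (g w) = w"
  shows "isomorphic_subspaces U W"
proof -
  have "bij_betw f U W"
    by (rule bij_betw_byWitness[where f' = g]) (use assms in auto)
  with assms show ?thesis
    unfolding isomorphic_subspaces_def by blast
qed

lemma isomorphic_subspaces_sym:
  assumes "isomorphic_subspaces U W"
  shows "isomorphic_subspaces W U"
proof -
  obtain f where f: "linear f" "bij_betw f U W" and sub: "subspace U" "subspace W"
    using assms unfolding isomorphic_subspaces_def by blast
  obtain g where g: "linear g" "\<forall>u\<in>U. g (f u) = u"
    using linear_exists_left_inverse_on[OF f(1) sub(1)] f(2) by (auto simp: bij_betw_def)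
  have "bij_betw g W U"
    by (rule bij_betw_byWitness[where f' = f]) (use f g in \<open>auto simp: bij_betw_def\<close>)
  with g sub show ?thesis
    unfolding isomorphic_subspaces_def by blast
qed

section \<open>Spaces of motions and self-stresses\<close>

lemma subspace_infinitesimal_motions: "subspace (infinitesimal_motions E p)"
proof -
  have add: "a \<bullet> (u + v - (u' + v')) = a \<bullet> (u - u') + a \<bullet> (v - v')" for a u v u' v' :: "real ^ 'a"
    by (simp add: algebra_simps)
  show ?thesis
    unfolding subspace_def infinitesimal_motions_def
    by (auto simp: add simp flip: scaleR_diff_right)
qed

lemma subspace_symmetric_motions: "subspace (symmetric_motions E S p)"
  using subspace_infinitesimal_motions[of E p]
  by (auto simp: subspace_def symmetric_motions_def matrix_vector_right_distrib
      matrix_vector_mult_scaleR)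

lemma subspace_trivial_motions: "subspace (trivial_motions E p)"
proof -
  have zero: "0 \<in> trivial_motions E p"
    using subspace_infinitesimal_motions[of E p]
    by (auto simp: trivial_motions_def subspace_def transpose_def vec_eq_iff
        intro!: exI[of _ 0])
  have add: "u + v \<in> trivial_motions E p"
    if uv: "u \<in> trivial_motions E p" "v \<in> trivial_motions E p" for u v
  proof -
    obtain A s where A: "transpose A = - A" "\<And>i. u $ i = A *v p $ i + s"
      using uv(1) by (auto simp: trivial_motions_def)
    obtain B t where B: "transpose B = - B" "\<And>i. v $ i = B *v p $ i + t"
      using uv(2) by (auto simp: trivial_motions_def)
    have "transpose (A + B) = transpose A + transpose B"
      by (simp add: vec_eq_iff transpose_def)
    then have "transpose (A + B) = - (A + B)"
      by (simp add: A(1) B(1))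
    moreover have "(u + v) $ i = (A + B) *v p $ i + (s + t)" for i
      by (simp add: A B matrix_vector_mult_add_rdistrib)
    moreover have "u + v \<in> infinitesimal_motions E p"
      using uv subspace_infinitesimal_motions[of E p]
      by (auto simp: trivial_motions_def subspace_add)
    ultimately show ?thesis
      unfolding trivial_motions_def by blast
  qed
  have scale: "c *\<^sub>R u \<in> trivial_motions E p" if u: "u \<in> trivial_motions E p" for c u
  proof -
    obtain A s where A: "transpose A = - A" "\<And>i. u $ i = A *v p $ i + s"
      using u by (auto simp: trivial_motions_def)
    have "transpose (c *\<^sub>R A) = c *\<^sub>R transpose A"
      by (simp add: vec_eq_iff transpose_def)
    then have "transpose (c *\<^sub>R A) = - (c *\<^sub>R A)"
      by (simp add: A(1))
    moreover have "(c *\<^sub>R u) $ i = (c *\<^sub>R A) *v p $ i + c *\<^sub>R s" for i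
      by (simp add: A scaleR_matrix_vector_assoc scaleR_add_right)
    moreover have "c *\<^sub>R u \<in> infinitesimal_motions E p"
      using u subspace_infinitesimal_motions[of E p]
      by (auto simp: trivial_motions_def subspace_scale)
    ultimately show ?thesis
      unfolding trivial_motions_def by blast
  qed
  show ?thesis
    using zero add scale by (simp add: subspace_def)
qed

lemma subspace_symmetric_trivial_motions: "subspace (symmetric_trivial_motions E S p)"
  unfolding symmetric_trivial_motions_def
  by (intro subspace_inter subspace_symmetric_motions subspace_trivial_motions)

lemma subspace_cone_joint_fixed: "subspace cone_joint_fixed"
  by (simp add: subspace_def cone_joint_fixed_def)

lemma constant_vec_trivial: "(\<chi> i. s) \<in> trivial_motions E p"
  unfolding trivial_motions_def infinitesimal_motions_def
  by (auto simp: transpose_def vec_eq_iff intro!: exI[of _ "0 :: real ^ 'a ^ 'a"])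

lemma symmetry_map_vertex_action:
  assumes "p \<in> symmetric_frameworks E S"
  shows "symmetry_map E S p (vertex_action E S p)"
  using assms unfolding symmetric_frameworks_def vertex_action_def
  by (simp add: some_eq_ex[of "symmetry_map E S p"])

lemma mult_eq_vertex_action:
  assumes "p \<in> symmetric_frameworks E S" "x \<in> S"
  shows "x *v p $ i = p $ vertex_action E S p x i"
  using symmetry_map_vertex_action[OF assms(1)] assms(2) by (simp add: symmetry_map_def)

lemma vertex_action_eqI:
  assumes "p \<in> symmetric_frameworks E S" "x \<in> S" "x *v p $ i = p $ j"
  shows "vertex_action E S p x i = j"
proof -
  have "inj (\<lambda>i. p $ i)"
    using assms(1) by (simp add: symmetric_frameworks_def framework_def)
  moreover have "p $ vertex_action E S p x i = p $ j"
    using assms(3) by (simp add: mult_eq_vertex_action[OF assms(1,2)])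
  ultimately show ?thesis
    by (simp add: inj_eq)
qed

lemma vertex_action_1:
  assumes "p \<in> symmetric_frameworks E S" "mat 1 \<in> S"
  shows "vertex_action E S p (mat 1) i = i"
  using assms by (intro vertex_action_eqI) auto

lemma vertex_action_graph_aut:
  assumes "p \<in> symmetric_frameworks E S" "x \<in> S"
  shows "vertex_action E S p x \<in> graph_aut E"
  using symmetry_map_vertex_action[OF assms(1)] assms(2) by (simp add: symmetry_map_def)

text \<open>
  An orbit contains the edge itself because the identity acts trivially, so constancy on orbits
  amounts to invariance under each group element.
\<close>

lemma symmetric_self_stresses_iff:
  assumes "p \<in> symmetric_frameworks E S" "mat 1 \<in> S"
  shows "\<omega> \<in> symmetric_self_stresses E S p \<longleftrightarrow> \<omega> \<in> self_stresses E p \<and>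
     (\<forall>e\<in>E. \<forall>x\<in>S. \<omega> $ (vertex_action E S p x ` e) = \<omega> $ e)"
proof -
  have "(\<lambda>f. \<omega> $ f) constant_on edge_orbit E S p e \<longleftrightarrow>
      (\<forall>x\<in>S. \<omega> $ (vertex_action E S p x ` e) = \<omega> $ e)" for e
  proof -
    have "vertex_action E S p (mat 1) ` e = e"
      by (simp add: vertex_action_1[OF assms])
    then have "e \<in> edge_orbit E S p e"
      using assms(2) unfolding edge_orbit_def by (metis (mono_tags, lifting) mem_Collect_eq)
    then have "(\<lambda>f. \<omega> $ f) constant_on edge_orbit E S p e \<longleftrightarrow>
        (\<forall>f\<in>edge_orbit E S p e. \<omega> $ f = \<omega> $ e)"
      unfolding constant_on_def by metis
    then show ?thesis
      by (auto simp: edge_orbit_def)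
  qed
  then show ?thesis
    by (simp add: symmetric_self_stresses_def)
qed

lemma subspace_self_stresses: "subspace (self_stresses E p)"
  unfolding subspace_def self_stresses_def
  by (simp add: scaleR_add_left sum.distrib flip: scaleR_scaleR scaleR_sum_right)

lemma subspace_symmetric_self_stresses:
  assumes "p \<in> symmetric_frameworks E S" "mat 1 \<in> S"
  shows "subspace (symmetric_self_stresses E S p)"
  using subspace_self_stresses[of E p]
  by (auto simp: subspace_def symmetric_self_stresses_iff[OF assms])

section \<open>Edges of the cone graph\<close>

lemma cone_graph_Some_Some: "{Some i, Some j} \<in> cone_graph E \<longleftrightarrow> {i, j} \<in> E"
proof
  assume "{Some i, Some j} \<in> cone_graph E"
  then obtain e where "e \<in> E" "Some ` e = Some ` {i, j}"
    unfolding cone_graph_def by auto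
  then show "{i, j} \<in> E"
    by (metis inj_Some inj_image_eq_iff)
next
  assume "{i, j} \<in> E"
  then have "Some ` {i, j} \<in> cone_graph E"
    unfolding cone_graph_def by blast
  then show "{Some i, Some j} \<in> cone_graph E"
    by simp
qed

lemma cone_graph_None_Some: "{None, Some i} \<in> cone_graph E" "{Some i, None} \<in> cone_graph E"
  by (auto simp: cone_graph_def insert_commute)

lemma cone_graph_None_None: "{None, None} \<notin> cone_graph E"
  by (auto simp: cone_graph_def)

lemmas cone_graph_edge_simps =
  cone_graph_Some_Some cone_graph_None_Some cone_graph_None_None

section \<open>Coned frameworks\<close>

text \<open>
  A symmetric framework together with a symmetric framework on the cone graph that projects to it
  from the cone joint, which is placed at the origin.
\<close>

locale coned_framework =
  fixes E :: "'v::finite set set"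
    and S :: "(real ^ 'd ^ 'd) set"
    and p :: "(real ^ 'd) ^ 'v"
    and q :: "(real ^ ('d option)) ^ ('v option)"
  assumes symmetry_group: "symmetry_group S"
    and base_framework: "p \<in> symmetric_frameworks E S"
    and cone_joint: "q $ None = 0"
    and cone_framework: "q \<in> symmetric_frameworks (cone_graph E) (star_mat ` S)"
    and projects: "projects_to q p"
begin

text \<open>
  The scalar with \<open>q\<^sub>i = \<alpha>\<^sub>i (p\<^sub>i, 1)\<close>, which is necessarily the last coordinate of \<open>q\<^sub>i\<close>.
\<close>

definition scale :: "'v \<Rightarrow> real" ("\<alpha>") where
  "\<alpha> i = q $ Some i $ None"

text \<open>The vertex actions of \<open>x\<close> on the base graph and of \<open>x\<^sup>*\<close> on the cone graph.\<close>

abbreviation act :: "real ^ 'd ^ 'd \<Rightarrow> 'v \<Rightarrow> 'v" ("\<sigma>") where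
  "\<sigma> \<equiv> vertex_action E S p"

abbreviation cone_act :: "real ^ 'd ^ 'd \<Rightarrow> 'v option \<Rightarrow> 'v option" ("\<tau>") where
  "\<tau> x \<equiv> vertex_action (cone_graph E) (star_mat ` S) q (star_mat x)"

lemma scale_nonzero: "\<alpha> i \<noteq> 0" and cone_point: "q $ Some i = append_coord (\<alpha> i *\<^sub>R p $ i) (\<alpha> i)"
proof -
  obtain c where "c \<noteq> 0" "q $ Some i = append_coord (c *\<^sub>R p $ i) c"
    using projects unfolding projects_to_def cone_lift_eq_append_coord
    by (auto simp: append_coord_scaleR)
  then show "\<alpha> i \<noteq> 0" "q $ Some i = append_coord (\<alpha> i *\<^sub>R p $ i) (\<alpha> i)"
    by (simp_all add: scale_def)
qed

lemma one_mem: "mat 1 \<in> S"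
  using symmetry_group subgroup.one_closed[of S orthogonal_group]
  by (simp add: symmetry_group_def orthogonal_group_def)

lemma one_mem_star: "mat 1 \<in> star_mat ` S"
  using one_mem star_mat_1 by (metis imageI)

lemma orthogonal: "x \<in> S \<Longrightarrow> orthogonal_matrix x"
  using symmetry_group subgroup.subset[of S orthogonal_group]
  by (auto simp: symmetry_group_def orthogonal_group_def)

lemma act_point: "x \<in> S \<Longrightarrow> x *v p $ i = p $ \<sigma> x i"
  by (rule mult_eq_vertex_action[OF base_framework])

lemma cone_act_point: "x \<in> S \<Longrightarrow> star_mat x *v q $ k = q $ \<tau> x k"
  by (rule mult_eq_vertex_action[OF cone_framework]) simp

lemma cone_act_None: "x \<in> S \<Longrightarrow> \<tau> x None = None"
  by (rule vertex_action_eqI[OF cone_framework]) (simp_all add: cone_joint)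

text \<open>
  A group element \<open>x\<^sup>*\<close> preserves the last coordinate. Hence \<open>\<alpha>\<close> is constant on vertex orbits, and
  the action on the cone graph extends the action on the base graph.
\<close>

lemma cone_act_Some: "x \<in> S \<Longrightarrow> \<tau> x (Some i) = Some (\<sigma> x i)"
  and scale_act: "x \<in> S \<Longrightarrow> \<alpha> (\<sigma> x i) = \<alpha> i"
proof -
  assume x: "x \<in> S"
  have eq: "q $ \<tau> x (Some i) = append_coord (\<alpha> i *\<^sub>R p $ \<sigma> x i) (\<alpha> i)"
    using cone_act_point[OF x, of "Some i"]
    by (simp add: cone_point star_mat_mult_append_coord matrix_vector_mult_scaleR act_point[OF x])
  show *: "\<tau> x (Some i) = Some (\<sigma> x i)"
  proof (cases "\<tau> x (Some i)")
    case None
    then have "append_coord (\<alpha> i *\<^sub>R p $ \<sigma> x i) (\<alpha> i) = append_coord 0 0"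
      using eq by (simp add: cone_joint)
    then show ?thesis
      by (simp only: append_coord_eq_iff scale_nonzero simp_thms)
  next
    case (Some j)
    have "\<alpha> j *\<^sub>R p $ j = \<alpha> i *\<^sub>R p $ \<sigma> x i \<and> \<alpha> j = \<alpha> i"
      using eq unfolding Some cone_point append_coord_eq_iff .
    then have "p $ j = p $ \<sigma> x i"
      using scaleR_left_imp_eq[OF scale_nonzero[of i]] by metis
    moreover have "inj (\<lambda>i. p $ i)"
      using base_framework by (simp add: symmetric_frameworks_def framework_def)
    ultimately show ?thesis
      using Some by (simp add: inj_eq)
  qed
  show "\<alpha> (\<sigma> x i) = \<alpha> i"
    using eq by (simp add: * cone_point)
qed

lemma act_bij: "x \<in> S \<Longrightarrow> bij (\<sigma> x)"
  and act_edge_iff: "x \<in> S \<Longrightarrow> {\<sigma> x i, \<sigma> x j} \<in> E \<longleftrightarrow> {i, j} \<in> E"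
  using vertex_action_graph_aut[OF base_framework] unfolding graph_aut_def by blast+

section \<open>Lifting motions to the cone\<close>

text \<open>
  The velocity at \<open>i\<close> is \<open>\<alpha>\<^sub>i (u\<^sub>i, - u\<^sub>i \<bullet> p\<^sub>i)\<close>: the last coordinate makes it orthogonal to \<open>q\<^sub>i\<close>, and
  the factor \<open>\<alpha>\<^sub>i\<close> makes the condition on a base edge \<open>{i, j}\<close> scale by \<open>\<alpha>\<^sub>i \<alpha>\<^sub>j\<close>.
\<close>

definition lift_motion :: "(real ^ 'd) ^ 'v \<Rightarrow> (real ^ ('d option)) ^ ('v option)" where
  "lift_motion u = (\<chi> k. case k of
       Some i \<Rightarrow> \<alpha> i *\<^sub>R append_coord (u $ i) (- (u $ i \<bullet> p $ i))
     | None \<Rightarrow> 0)"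

text \<open>The inverse of \<open>lift_motion\<close> on motions of the cone that fix the cone joint.\<close>

definition drop_motion :: "(real ^ ('d option)) ^ ('v option) \<Rightarrow> (real ^ 'd) ^ 'v" where
  "drop_motion U = (\<chi> i. (1 / \<alpha> i) *\<^sub>R drop_coord (U $ Some i))"

lemma lift_motion_nth [simp]:
  "lift_motion u $ Some i = \<alpha> i *\<^sub>R append_coord (u $ i) (- (u $ i \<bullet> p $ i))"
  "lift_motion u $ None = 0"
  by (simp_all add: lift_motion_def)

lemma linear_lift_motion: "linear lift_motion"
  by (rule linearI)
    (simp_all add: vec_option_eq_iff inner_add_left distrib_left right_diff_distrib)

lemma drop_lift_motion: "drop_motion (lift_motion u) = u"
  by (simp add: vec_eq_iff drop_motion_def scale_nonzero)

lemma lift_motion_edge: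
  "(q $ Some i - q $ Some j) \<bullet> (lift_motion u $ Some i - lift_motion u $ Some j) =
     \<alpha> i * \<alpha> j * ((p $ i - p $ j) \<bullet> (u $ i - u $ j))"
proof -
  have [simp]: "v \<bullet> p $ k = p $ k \<bullet> v" for v k
    by (rule inner_commute)
  show ?thesis
    by (simp add: cone_point append_coord_scaleR append_coord_diff inner_append_coord
        inner_diff_left inner_diff_right) algebra
qed

lemma lift_motion_spoke: "q $ Some i \<bullet> lift_motion u $ Some i = 0"
  by (simp add: cone_point append_coord_scaleR inner_append_coord inner_commute)

text \<open>The spokes force each velocity of a motion fixing the cone joint into the image of the lift.\<close>

lemma lift_drop_motion:
  assumes "U \<in> infinitesimal_motions (cone_graph E) q" "U \<in> cone_joint_fixed"
  shows "lift_motion (drop_motion U) = U"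
proof -
  have "U $ Some i = lift_motion (drop_motion U) $ Some i" for i
  proof -
    have "q $ Some i \<bullet> U $ Some i = 0"
      using assms cone_graph_None_Some(2)[of i E] cone_joint
      by (force simp: infinitesimal_motions_def cone_joint_fixed_def)
    moreover have "q $ Some i \<bullet> U $ Some i =
        \<alpha> i * (p $ i \<bullet> drop_coord (U $ Some i) + U $ Some i $ None)"
      unfolding cone_point
      by (subst (1) append_drop_coord[of "U $ Some i", symmetric], subst inner_append_coord)
        (simp add: algebra_simps)
    ultimately have "U $ Some i $ None = - (p $ i \<bullet> drop_coord (U $ Some i))"
      using scale_nonzero[of i] by simp
    then have "U $ Some i =
        append_coord (drop_coord (U $ Some i)) (- (p $ i \<bullet> drop_coord (U $ Some i)))"
      by (metis append_drop_coord)
    also have "\<dots> = lift_motion (drop_motion U) $ Some i"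
      by (simp add: drop_motion_def append_coord_scaleR scale_nonzero inner_commute)
    finally show ?thesis .
  qed
  moreover have "U $ None = 0"
    using assms(2) by (simp add: cone_joint_fixed_def)
  ultimately show ?thesis
    by (simp add: vec_eq_iff[of "lift_motion _"] split_option_all del: lift_motion_nth(1))
qed

lemma lift_motion_infinitesimal_iff:
  "lift_motion u \<in> infinitesimal_motions (cone_graph E) q \<longleftrightarrow> u \<in> infinitesimal_motions E p"
proof -
  have "(q $ None - q $ Some i) \<bullet> (lift_motion u $ None - lift_motion u $ Some i) = 0"
    "(q $ Some i - q $ None) \<bullet> (lift_motion u $ Some i - lift_motion u $ None) = 0" for i
    using lift_motion_spoke[of i u] by (simp_all add: cone_joint)
  then show ?thesis
    unfolding infinitesimal_motions_def mem_Collect_eq split_option_all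
    by (simp add: cone_graph_edge_simps lift_motion_edge scale_nonzero del: lift_motion_nth)
qed

lemma lift_motion_symmetric_iff:
  "lift_motion u \<in> symmetric_motions (cone_graph E) (star_mat ` S) q \<longleftrightarrow>
     u \<in> symmetric_motions E S p"
proof -
  have "star_mat x *v lift_motion u $ Some i = lift_motion u $ \<tau> x (Some i) \<longleftrightarrow>
      x *v u $ i = u $ \<sigma> x i" if x: "x \<in> S" for x i
  proof -
    have "u $ \<sigma> x i \<bullet> p $ \<sigma> x i = u $ i \<bullet> p $ i" if "x *v u $ i = u $ \<sigma> x i"
      using inner_orthogonal_matrix[OF orthogonal[OF x], of "u $ i" "p $ i"]
      by (simp add: that act_point[OF x])
    then show ?thesis
      by (auto simp: cone_act_Some[OF x] scale_act[OF x] scale_nonzero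
          matrix_vector_mult_scaleR star_mat_mult_append_coord)
  qed
  then show ?thesis
    by (simp add: symmetric_motions_def lift_motion_infinitesimal_iff split_option_all
        cone_act_None del: lift_motion_nth(1))
qed

text \<open>
  The lift of \<open>u\<^sub>i = A p\<^sub>i + t\<close> has velocities \<open>B q\<^sub>i\<close> for the skew-symmetric matrix \<open>B\<close> with blocks
  \<open>A, t, - t\<^sup>T, 0\<close>; conversely every trivial motion fixing the cone joint has no translation part.
\<close>

lemma lift_motion_trivial_iff:
  "lift_motion u \<in> trivial_motions (cone_graph E) q \<longleftrightarrow> u \<in> trivial_motions E p"
proof -
  have block: "skew_block A t *v q $ Some i = \<alpha> i *\<^sub>R append_coord (A *v p $ i + t) (- (t \<bullet> p $ i))"
    for A t i
    by (simp add: cone_point skew_block_mult_append_coord append_coord_scaleR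
        matrix_vector_mult_scaleR scaleR_add_right)
  have "(\<exists>B s. transpose B = - B \<and> (\<forall>k. lift_motion u $ k = B *v q $ k + s)) \<longleftrightarrow>
      (\<exists>A t. transpose A = - A \<and> (\<forall>i. u $ i = A *v p $ i + t))"
  proof
    assume "\<exists>B s. transpose B = - B \<and> (\<forall>k. lift_motion u $ k = B *v q $ k + s)"
    then obtain B s where B: "transpose B = - B" and u: "\<And>k. lift_motion u $ k = B *v q $ k + s"
      by blast
    obtain A t where A: "transpose A = - A" "B = skew_block A t"
      using skew_matrix_eq_skew_block[OF B] .
    have "s = 0"
      using u[of None] by (simp add: cone_joint)
    then have "u $ i = A *v p $ i + t" for i
      using u[of "Some i"] by (simp add: A block scale_nonzero)
    then show "\<exists>A t. transpose A = - A \<and> (\<forall>i. u $ i = A *v p $ i + t)"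
      using A by blast
  next
    assume "\<exists>A t. transpose A = - A \<and> (\<forall>i. u $ i = A *v p $ i + t)"
    then obtain A t where A: "transpose A = - A" and u: "\<And>i. u $ i = A *v p $ i + t"
      by blast
    have "lift_motion u $ Some i = skew_block A t *v q $ Some i + 0" for i
      by (simp add: block u inner_add_left inner_skew_self_eq_0[OF A])
    then have "\<forall>k. lift_motion u $ k = skew_block A t *v q $ k + 0"
      by (simp add: split_option_all cone_joint del: lift_motion_nth(1))
    with transpose_skew_block[OF A]
    show "\<exists>B s. transpose B = - B \<and> (\<forall>k. lift_motion u $ k = B *v q $ k + s)"
      by blast
  qed
  then show ?thesis
    by (simp add: trivial_motions_def lift_motion_infinitesimal_iff)
qed

lemma lift_motion_cone_joint_fixed: "lift_motion u \<in> cone_joint_fixed"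
  by (simp add: cone_joint_fixed_def)

lemma lift_drop_symmetric_motion:
  "U \<in> symmetric_motions (cone_graph E) (star_mat ` S) q \<Longrightarrow> U \<in> cone_joint_fixed \<Longrightarrow>
     lift_motion (drop_motion U) = U"
  by (rule lift_drop_motion) (simp_all add: symmetric_motions_def)

lemma isomorphic_symmetric_motions:
  "isomorphic_subspaces
     (symmetric_motions E S p)
     (symmetric_motions (cone_graph E) (star_mat ` S) q \<inter> cone_joint_fixed)"
proof (rule isomorphic_subspacesI[of _ _ lift_motion drop_motion])
  fix U assume "U \<in> symmetric_motions (cone_graph E) (star_mat ` S) q \<inter> cone_joint_fixed"
  then show "lift_motion (drop_motion U) = U" "drop_motion U \<in> symmetric_motions E S p"
    using lift_drop_symmetric_motion[of U] lift_motion_symmetric_iff[of "drop_motion U"] by auto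
qed (simp_all add: subspace_symmetric_motions subspace_inter subspace_cone_joint_fixed
      linear_lift_motion drop_lift_motion lift_motion_symmetric_iff lift_motion_cone_joint_fixed)

lemma lift_motion_symmetric_trivial_iff:
  "lift_motion u \<in> symmetric_trivial_motions (cone_graph E) (star_mat ` S) q \<longleftrightarrow>
     u \<in> symmetric_trivial_motions E S p"
  by (simp add: symmetric_trivial_motions_def lift_motion_symmetric_iff lift_motion_trivial_iff)

lemma isomorphic_symmetric_trivial_motions:
  "isomorphic_subspaces
     (symmetric_trivial_motions E S p)
     (symmetric_trivial_motions (cone_graph E) (star_mat ` S) q \<inter> cone_joint_fixed)"
proof (rule isomorphic_subspacesI[of _ _ lift_motion drop_motion])
  fix U assume U: "U \<in> symmetric_trivial_motions (cone_graph E) (star_mat ` S) q \<inter> cone_joint_fixed"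
  then show "lift_motion (drop_motion U) = U"
    using lift_drop_symmetric_motion[of U] by (simp add: symmetric_trivial_motions_def)
  with U show "drop_motion U \<in> symmetric_trivial_motions E S p"
    using lift_motion_symmetric_trivial_iff[of "drop_motion U"] by simp
qed (simp_all add: subspace_symmetric_trivial_motions subspace_inter subspace_cone_joint_fixed
      linear_lift_motion drop_lift_motion lift_motion_symmetric_trivial_iff
      lift_motion_cone_joint_fixed)

text \<open>
  The velocity of the cone joint in a symmetric motion is fixed by the group, so subtracting it as a
  translation leaves a symmetric motion that fixes the cone joint.
\<close>

lemma nontrivial_symmetric_motion_iff:
  "(\<exists>u. u \<in> symmetric_motions E S p \<and> u \<notin> trivial_motions E p) \<longleftrightarrow>
   (\<exists>U. U \<in> symmetric_motions (cone_graph E) (star_mat ` S) q \<and>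
        U \<notin> trivial_motions (cone_graph E) q)"
proof
  assume "\<exists>u. u \<in> symmetric_motions E S p \<and> u \<notin> trivial_motions E p"
  then show "\<exists>U. U \<in> symmetric_motions (cone_graph E) (star_mat ` S) q \<and>
      U \<notin> trivial_motions (cone_graph E) q"
    using lift_motion_symmetric_iff lift_motion_trivial_iff by blast
next
  assume "\<exists>U. U \<in> symmetric_motions (cone_graph E) (star_mat ` S) q \<and>
      U \<notin> trivial_motions (cone_graph E) q"
  then obtain U where U: "U \<in> symmetric_motions (cone_graph E) (star_mat ` S) q"
    and nontriv: "U \<notin> trivial_motions (cone_graph E) q"
    by blast
  define T :: "(real ^ ('d option)) ^ ('v option)" where "T = (\<chi> k. U $ None)"
  have T: "T \<in> trivial_motions (cone_graph E) q"
    unfolding T_def by (rule constant_vec_trivial)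
  have "star_mat x *v U $ None = U $ None" if "x \<in> S" for x
    using U that cone_act_None[OF that] by (force simp: symmetric_motions_def)
  then have "T \<in> symmetric_motions (cone_graph E) (star_mat ` S) q"
    using T by (auto simp: symmetric_motions_def trivial_motions_def T_def)
  with U have "U - T \<in> symmetric_motions (cone_graph E) (star_mat ` S) q"
    by (intro subspace_diff subspace_symmetric_motions)
  moreover from this have "lift_motion (drop_motion (U - T)) = U - T"
    by (rule lift_drop_symmetric_motion) (simp add: cone_joint_fixed_def T_def)
  moreover have "U - T \<notin> trivial_motions (cone_graph E) q"
    using nontriv subspace_add[OF subspace_trivial_motions _ T, of "U - T"] by auto
  ultimately show "\<exists>u. u \<in> symmetric_motions E S p \<and> u \<notin> trivial_motions E p"
    using lift_motion_symmetric_iff lift_motion_trivial_iff by metis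
qed

section \<open>Transferring self-stresses to the cone\<close>

abbreviation nbrs :: "'v \<Rightarrow> 'v set" where
  "nbrs i \<equiv> {j. {i, j} \<in> E}"

lemma edge_card: "e \<in> E \<Longrightarrow> card e = 2"
  using base_framework by (auto simp: symmetric_frameworks_def framework_def simple_graph_def)

lemma prod_scale_edge: "{i, j} \<in> E \<Longrightarrow> (\<Prod>k\<in>{i, j}. \<alpha> k) = \<alpha> i * \<alpha> j"
  using edge_card[of "{i, j}"] by (cases "i = j") auto

lemma prod_scale_nonzero: "(\<Prod>k\<in>e. \<alpha> k) \<noteq> 0"
  by (simp add: scale_nonzero)

lemma prod_scale_act: "x \<in> S \<Longrightarrow> (\<Prod>k\<in>\<sigma> x ` e. \<alpha> k) = (\<Prod>k\<in>e. \<alpha> k)"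
  using act_bij[of x] by (subst prod.reindex) (auto simp: bij_def scale_act intro: inj_on_subset)

text \<open>
  The restriction of a self-stress of the cone to the base edges, rescaled by
  \<open>\<omega>\<^sub>i\<^sub>j = \<alpha>\<^sub>i \<alpha>\<^sub>j W\<^sub>i\<^sub>j\<close>. The product over the vertices of the edge makes sense for every vertex set.
\<close>

definition drop_stress :: "real ^ ('v option set) \<Rightarrow> real ^ ('v set)" where
  "drop_stress W = (\<chi> e. (\<Prod>k\<in>e. \<alpha> k) * W $ (Some ` e))"

text \<open>
  The coefficient of the spoke at \<open>i\<close> that balances the last coordinates at that vertex, when every
  edge \<open>{i, j}\<close> of the base carries \<open>\<omega>\<^sub>i\<^sub>j / (\<alpha>\<^sub>i \<alpha>\<^sub>j)\<close>.
\<close>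

definition spoke_stress :: "real ^ ('v set) \<Rightarrow> 'v \<Rightarrow> real" where
  "spoke_stress \<omega> i = - (\<Sum>j\<in>nbrs i. \<omega> $ {i, j} / (\<Prod>k\<in>{i, j}. \<alpha> k) * (\<alpha> i - \<alpha> j)) / \<alpha> i"

text \<open>
  The inverse of \<open>drop_stress\<close> on self-stresses of the cone.
  A set containing \<open>None\<close> is an edge of the cone graph only if it is a spoke \<open>{None, Some i}\<close>, and
  then the inner sum has the single summand belonging to \<open>i\<close>.
\<close>

definition lift_stress :: "real ^ ('v set) \<Rightarrow> real ^ ('v option set)" where
  "lift_stress \<omega> = (\<chi> F.
     if None \<notin> F then \<omega> $ (Some -` F) / (\<Prod>k\<in>Some -` F. \<alpha> k)
     else if F \<in> cone_graph E then \<Sum>i\<in>Some -` F. spoke_stress \<omega> i else 0)"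

lemma linear_drop_stress: "linear drop_stress"
  by (rule linearI) (simp_all add: vec_eq_iff drop_stress_def distrib_left)

lemma drop_stress_nth [simp]: "drop_stress W $ e = (\<Prod>k\<in>e. \<alpha> k) * W $ (Some ` e)"
  by (simp add: drop_stress_def)

lemma lift_stress_Some: "lift_stress \<omega> $ (Some ` e) = \<omega> $ e / (\<Prod>k\<in>e. \<alpha> k)"
  by (auto simp: lift_stress_def inj_vimage_image_eq)

lemma lift_stress_spoke: "lift_stress \<omega> $ {None, Some i} = spoke_stress \<omega> i"
proof -
  have "Some -` {None, Some i} = {i}"
    by auto
  then show ?thesis
    by (simp add: lift_stress_def cone_graph_None_Some)
qed

lemma drop_lift_stress: "drop_stress (lift_stress \<omega>) = \<omega>"
  by (simp add: vec_eq_iff lift_stress_Some prod_scale_nonzero)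

lemma image_Some_cone_graph_iff: "Some ` e \<in> cone_graph E \<longleftrightarrow> e \<in> E"
  by (auto simp: cone_graph_def inj_image_eq_iff)

lemma set_option_cases:
  obtains (base) e where "F = Some ` e" | (apex) "None \<in> F"
proof (cases "None \<in> F")
  case False
  then have "F = Some ` (Some -` F)"
    by (auto simp: image_iff) (metis not_None_eq)
  then show ?thesis by (rule base)
qed (rule apex)

lemma lift_stress_outside:
  assumes "\<And>e. e \<notin> E \<Longrightarrow> \<omega> $ e = 0" "F \<notin> cone_graph E"
  shows "lift_stress \<omega> $ F = 0"
proof (cases F rule: set_option_cases)
  case (base e)
  then show ?thesis
    using assms by (simp add: lift_stress_Some image_Some_cone_graph_iff)
next
  case apex
  then show ?thesis
    using assms(2) by (simp add: lift_stress_def)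
qed

lemma cone_edge_cases:
  assumes "F \<in> cone_graph E"
  obtains (base) e where "e \<in> E" "F = Some ` e" | (spoke) i where "F = {None, Some i}"
  using assms unfolding cone_graph_def by blast

text \<open>The equilibrium condition at a vertex splits into the last coordinate and a condition on \<open>p\<close>.\<close>

lemma cone_equilibrium_iff:
  "c *\<^sub>R q $ Some i + (\<Sum>j\<in>N. w j *\<^sub>R (q $ Some i - q $ Some j)) = 0 \<longleftrightarrow>
     c * \<alpha> i + (\<Sum>j\<in>N. w j * (\<alpha> i - \<alpha> j)) = 0 \<and>
     (\<Sum>j\<in>N. (w j * \<alpha> j) *\<^sub>R (p $ i - p $ j)) = 0"
proof -
  define a where "a = append_coord (p $ i) 1"
  define m where "m = c * \<alpha> i + (\<Sum>j\<in>N. w j * (\<alpha> i - \<alpha> j))"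
  define s where "s = (\<Sum>j\<in>N. (w j * \<alpha> j) *\<^sub>R (p $ i - p $ j))"
  have sum: "(\<Sum>j\<in>N. append_coord (v j) 0) = append_coord (\<Sum>j\<in>N. v j) 0"
    for v :: "'v \<Rightarrow> real ^ 'd"
    by (simp add: vec_option_eq_iff)
  have "w j *\<^sub>R (q $ Some i - q $ Some j) =
      (w j * (\<alpha> i - \<alpha> j)) *\<^sub>R a + append_coord ((w j * \<alpha> j) *\<^sub>R (p $ i - p $ j)) 0" for j
    by (simp add: a_def cone_point vec_option_eq_iff algebra_simps)
  moreover have "c *\<^sub>R q $ Some i = (c * \<alpha> i) *\<^sub>R a"
    by (simp add: a_def cone_point append_coord_scaleR)
  ultimately have "c *\<^sub>R q $ Some i + (\<Sum>j\<in>N. w j *\<^sub>R (q $ Some i - q $ Some j)) =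
      m *\<^sub>R a + append_coord s 0"
    by (simp add: sum.distrib sum m_def s_def scaleR_add_left flip: scaleR_sum_left)
  also have "\<dots> = append_coord (m *\<^sub>R p $ i + s) m"
    by (simp add: a_def append_coord_scaleR append_coord_add)
  also have "\<dots> = 0 \<longleftrightarrow> m = 0 \<and> s = 0"
    unfolding append_coord_0[symmetric] append_coord_eq_iff by auto
  finally show ?thesis
    by (simp only: m_def s_def)
qed

text \<open>
  The equilibrium condition at the cone joint is redundant: it is the sum of the conditions at the
  other vertices, in which the contributions of the base edges cancel in pairs.
\<close>

lemma cone_joint_equilibrium:
  assumes "\<And>i. W $ {None, Some i} *\<^sub>R q $ Some i +
      (\<Sum>j\<in>nbrs i. W $ {Some i, Some j} *\<^sub>R (q $ Some i - q $ Some j)) = 0"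
  shows "(\<Sum>i\<in>UNIV. W $ {None, Some i} *\<^sub>R q $ Some i) = 0"
proof -
  define g where "g i j =
    (if {i, j} \<in> E then W $ {Some i, Some j} *\<^sub>R (q $ Some i - q $ Some j) else 0)" for i j
  have anti: "g i j = - g j i" for i j
    by (simp add: g_def insert_commute flip: scaleR_minus_right)
  have "(\<Sum>i\<in>UNIV. \<Sum>j\<in>UNIV. g i j) = (\<Sum>j\<in>UNIV. \<Sum>i\<in>UNIV. g i j)"
    by (rule sum.swap)
  also have "\<dots> = - (\<Sum>j\<in>UNIV. \<Sum>i\<in>UNIV. g j i)"
    by (subst anti) (simp add: sum_negf)
  finally have g0: "(\<Sum>i\<in>UNIV. \<Sum>j\<in>UNIV. g i j) = 0"
    by (simp add: eq_neg_iff_add_eq_0 flip: scaleR_2)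
  have "W $ {None, Some i} *\<^sub>R q $ Some i = - (\<Sum>j\<in>UNIV. g i j)" for i
    using assms[of i] by (simp add: g_def eq_neg_iff_add_eq_0 flip: sum.inter_filter)
  then show ?thesis
    by (simp add: sum_negf g0)
qed

lemma cone_self_stresses_iff:
  "W \<in> self_stresses (cone_graph E) q \<longleftrightarrow>
     (\<forall>F. F \<notin> cone_graph E \<longrightarrow> W $ F = 0) \<and> drop_stress W \<in> self_stresses E p \<and>
     (\<forall>i. W $ {None, Some i} * \<alpha> i + (\<Sum>j\<in>nbrs i. W $ {Some i, Some j} * (\<alpha> i - \<alpha> j)) = 0)"
proof (cases "\<forall>F. F \<notin> cone_graph E \<longrightarrow> W $ F = 0")
  case True
  define R where "R i \<longleftrightarrow> W $ {None, Some i} *\<^sub>R q $ Some i +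
      (\<Sum>j\<in>nbrs i. W $ {Some i, Some j} *\<^sub>R (q $ Some i - q $ Some j)) = 0" for i
  have "(\<Sum>k | {Some i, k} \<in> cone_graph E. W $ {Some i, k} *\<^sub>R (q $ Some i - q $ k)) =
      W $ {None, Some i} *\<^sub>R q $ Some i +
      (\<Sum>j\<in>nbrs i. W $ {Some i, Some j} *\<^sub>R (q $ Some i - q $ Some j))" for i
  proof -
    have "{k. {Some i, k} \<in> cone_graph E} = insert None (Some ` nbrs i)"
      by (auto simp: set_eq_iff split_option_all cone_graph_edge_simps)
    then show ?thesis
      by (simp add: sum.reindex cone_joint insert_commute)
  qed
  moreover have "(\<Sum>k | {None, k} \<in> cone_graph E. W $ {None, k} *\<^sub>R (q $ None - q $ k)) = 0"
    if "\<And>i. R i"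
  proof -
    have "{k. {None, k} \<in> cone_graph E} = range Some"
      using cone_graph_None_None[of E]
      by (auto simp: set_eq_iff split_option_all cone_graph_edge_simps)
    then show ?thesis
      using cone_joint_equilibrium[of W] that
      by (simp add: sum.reindex cone_joint sum_negf R_def)
  qed
  ultimately have "W \<in> self_stresses (cone_graph E) q \<longleftrightarrow> (\<forall>i. R i)"
    using True by (auto simp: self_stresses_def split_option_all R_def)
  moreover have "R i \<longleftrightarrow>
      W $ {None, Some i} * \<alpha> i + (\<Sum>j\<in>nbrs i. W $ {Some i, Some j} * (\<alpha> i - \<alpha> j)) = 0 \<and>
      (\<Sum>j\<in>nbrs i. drop_stress W $ {i, j} *\<^sub>R (p $ i - p $ j)) = 0" for i
  proof -
    have "(\<Sum>j\<in>nbrs i. drop_stress W $ {i, j} *\<^sub>R (p $ i - p $ j)) =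
        \<alpha> i *\<^sub>R (\<Sum>j\<in>nbrs i. (W $ {Some i, Some j} * \<alpha> j) *\<^sub>R (p $ i - p $ j))"
      unfolding scaleR_sum_right
      by (intro sum.cong refl) (simp add: prod_scale_edge mult_ac)
    then show ?thesis
      unfolding R_def cone_equilibrium_iff by (simp add: scale_nonzero)
  qed
  moreover have "drop_stress W $ e = 0" if "e \<notin> E" for e
    using True that by (simp add: image_Some_cone_graph_iff)
  ultimately show ?thesis
    using True by (auto simp: self_stresses_def simp del: drop_stress_nth)
qed (auto simp: self_stresses_def)

lemma lift_stress_self_stress:
  assumes "\<omega> \<in> self_stresses E p"
  shows "lift_stress \<omega> \<in> self_stresses (cone_graph E) q"
proof -
  have "lift_stress \<omega> $ {None, Some i} * \<alpha> i +
      (\<Sum>j\<in>nbrs i. lift_stress \<omega> $ {Some i, Some j} * (\<alpha> i - \<alpha> j)) = 0" for i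
    using lift_stress_Some[of \<omega> "{i, j}" for j]
    by (simp add: lift_stress_spoke spoke_stress_def scale_nonzero)
  moreover have "lift_stress \<omega> $ F = 0" if "F \<notin> cone_graph E" for F
    using assms that by (intro lift_stress_outside) (auto simp: self_stresses_def)
  ultimately show ?thesis
    using assms by (simp add: cone_self_stresses_iff drop_lift_stress)
qed

lemma lift_drop_stress:
  assumes W: "W \<in> self_stresses (cone_graph E) q"
  shows "lift_stress (drop_stress W) = W"
proof -
  have "lift_stress (drop_stress W) $ F = W $ F" for F
  proof (cases "F \<in> cone_graph E")
    case True
    then show ?thesis
    proof (cases rule: cone_edge_cases)
      case (base e)
      then show ?thesis
        by (simp add: lift_stress_Some prod_scale_nonzero)
    next
      case (spoke i)
      have "W $ {None, Some i} * \<alpha> i = - (\<Sum>j\<in>nbrs i. W $ {Some i, Some j} * (\<alpha> i - \<alpha> j))"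
        using W by (simp add: cone_self_stresses_iff eq_neg_iff_add_eq_0)
      then have "W $ {None, Some i} = - (\<Sum>j\<in>nbrs i. W $ {Some i, Some j} * (\<alpha> i - \<alpha> j)) / \<alpha> i"
        by (simp only: nonzero_eq_divide_eq[OF scale_nonzero])
      moreover have "drop_stress W $ {i, j} / (\<Prod>k\<in>{i, j}. \<alpha> k) = W $ {Some i, Some j}" for j
        using prod_scale_nonzero[of "{i, j}"] by simp
      ultimately show ?thesis
        by (simp only: spoke lift_stress_spoke spoke_stress_def)
    qed
  next
    case False
    moreover have "drop_stress W \<in> self_stresses E p"
      using W by (simp add: cone_self_stresses_iff)
    ultimately show ?thesis
      using W lift_stress_outside[of "drop_stress W" F]
      by (simp add: self_stresses_def del: drop_stress_nth)
  qed
  then show ?thesis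
    by (simp add: vec_eq_iff)
qed

lemma spoke_stress_act:
  assumes x: "x \<in> S" and inv: "\<And>e. e \<in> E \<Longrightarrow> \<omega> $ (\<sigma> x ` e) = \<omega> $ e"
  shows "spoke_stress \<omega> (\<sigma> x i) = spoke_stress \<omega> i"
proof -
  have "bij_betw (\<sigma> x) (nbrs i) (nbrs (\<sigma> x i))"
    unfolding bij_betw_def
  proof
    show "inj_on (\<sigma> x) (nbrs i)"
      using act_bij[OF x] by (auto simp: bij_def intro: inj_on_subset)
    show "\<sigma> x ` nbrs i = nbrs (\<sigma> x i)"
    proof
      show "\<sigma> x ` nbrs i \<subseteq> nbrs (\<sigma> x i)"
        using act_edge_iff[OF x] by auto
      show "nbrs (\<sigma> x i) \<subseteq> \<sigma> x ` nbrs i"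
      proof
        fix k assume k: "k \<in> nbrs (\<sigma> x i)"
        obtain j where "k = \<sigma> x j"
          using act_bij[OF x] by (metis bij_pointE)
        with k show "k \<in> \<sigma> x ` nbrs i"
          using act_edge_iff[OF x, of i j] by blast
      qed
    qed
  qed
  then have "(\<Sum>j\<in>nbrs (\<sigma> x i). \<omega> $ {\<sigma> x i, j} / (\<Prod>k\<in>{\<sigma> x i, j}. \<alpha> k) * (\<alpha> (\<sigma> x i) - \<alpha> j)) =
      (\<Sum>j\<in>nbrs i. \<omega> $ {\<sigma> x i, \<sigma> x j} / (\<Prod>k\<in>{\<sigma> x i, \<sigma> x j}. \<alpha> k) * (\<alpha> (\<sigma> x i) - \<alpha> (\<sigma> x j)))"
    by (rule sum.reindex_bij_betw[symmetric])
  also have "\<dots> = (\<Sum>j\<in>nbrs i. \<omega> $ {i, j} / (\<Prod>k\<in>{i, j}. \<alpha> k) * (\<alpha> i - \<alpha> j))"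
  proof (intro sum.cong refl)
    fix j assume "j \<in> nbrs i"
    then have "\<omega> $ {\<sigma> x i, \<sigma> x j} = \<omega> $ {i, j}"
      using inv[of "{i, j}"] by simp
    moreover have "(\<Prod>k\<in>{\<sigma> x i, \<sigma> x j}. \<alpha> k) = (\<Prod>k\<in>{i, j}. \<alpha> k)"
      using prod_scale_act[OF x, of "{i, j}"] by simp
    ultimately show "\<omega> $ {\<sigma> x i, \<sigma> x j} / (\<Prod>k\<in>{\<sigma> x i, \<sigma> x j}. \<alpha> k) * (\<alpha> (\<sigma> x i) - \<alpha> (\<sigma> x j)) =
        \<omega> $ {i, j} / (\<Prod>k\<in>{i, j}. \<alpha> k) * (\<alpha> i - \<alpha> j)"
      by (simp only: scale_act[OF x])
  qed
  finally show ?thesis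
    by (simp only: spoke_stress_def scale_act[OF x])
qed

lemma cone_act_image_Some: "x \<in> S \<Longrightarrow> \<tau> x ` Some ` e = Some ` \<sigma> x ` e"
  by (simp add: image_image cone_act_Some)

text \<open>
  Linearity is immediate for \<open>drop_stress\<close>, so the isomorphism is built from the cone to the base.
\<close>

lemma isomorphic_symmetric_self_stresses:
  "isomorphic_subspaces
     (symmetric_self_stresses E S p)
     (symmetric_self_stresses (cone_graph E) (star_mat ` S) q)"
proof (rule isomorphic_subspaces_sym, rule isomorphic_subspacesI[of _ _ drop_stress lift_stress])
  note base_iff = symmetric_self_stresses_iff[OF base_framework one_mem]
  note cone_iff = symmetric_self_stresses_iff[OF cone_framework one_mem_star]
  show "subspace (symmetric_self_stresses E S p)"
    by (rule subspace_symmetric_self_stresses[OF base_framework one_mem])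
  show "subspace (symmetric_self_stresses (cone_graph E) (star_mat ` S) q)"
    by (rule subspace_symmetric_self_stresses[OF cone_framework one_mem_star])
  show "linear drop_stress"
    by (rule linear_drop_stress)
  show "drop_stress (lift_stress \<omega>) = \<omega>" for \<omega>
    by (rule drop_lift_stress)
  fix W assume W: "W \<in> symmetric_self_stresses (cone_graph E) (star_mat ` S) q"
  then show "lift_stress (drop_stress W) = W"
    by (simp add: cone_iff lift_drop_stress)
  have "drop_stress W $ (\<sigma> x ` e) = drop_stress W $ e" if "e \<in> E" "x \<in> S" for e x
  proof -
    have "W $ (\<tau> x ` Some ` e) = W $ (Some ` e)"
      using W that by (simp add: cone_iff image_Some_cone_graph_iff del: image_image)
    then show ?thesis
      by (simp add: cone_act_image_Some prod_scale_act that)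
  qed
  then show "drop_stress W \<in> symmetric_self_stresses E S p"
    using W by (simp add: base_iff cone_iff cone_self_stresses_iff del: drop_stress_nth)
next
  note base_iff = symmetric_self_stresses_iff[OF base_framework one_mem]
  note cone_iff = symmetric_self_stresses_iff[OF cone_framework one_mem_star]
  fix \<omega> assume \<omega>: "\<omega> \<in> symmetric_self_stresses E S p"
  have "lift_stress \<omega> $ (\<tau> x ` F) = lift_stress \<omega> $ F" if F: "F \<in> cone_graph E" and x: "x \<in> S" for F x
    using F
  proof (cases rule: cone_edge_cases)
    case (base e)
    have "\<omega> $ (\<sigma> x ` e) = \<omega> $ e"
      using \<omega> base(1) x by (simp add: base_iff)
    then show ?thesis
      by (simp only: base(2) cone_act_image_Some[OF x] lift_stress_Some prod_scale_act[OF x])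
  next
    case (spoke i)
    then have "\<tau> x ` F = {None, Some (\<sigma> x i)}"
      by (simp add: cone_act_None[OF x] cone_act_Some[OF x])
    moreover have "spoke_stress \<omega> (\<sigma> x i) = spoke_stress \<omega> i"
      using \<omega> x by (intro spoke_stress_act) (simp_all add: base_iff)
    ultimately show ?thesis
      by (simp add: spoke lift_stress_spoke)
  qed
  then show "lift_stress \<omega> \<in> symmetric_self_stresses (cone_graph E) (star_mat ` S) q"
    using \<omega> by (auto simp: base_iff cone_iff lift_stress_self_stress)
qed

end

section \<open>Coning preserves symmetric motions and self-stresses\<close>

theorem theorem3p6:
  fixes E :: "'v::finite set set"
    and S :: "(real ^ 'd ^ 'd) set"
    and p :: "(real ^ 'd) ^ 'v"
    and q :: "(real ^ ('d option)) ^ ('v option)"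
  assumes "symmetry_group S"
    and "p \<in> symmetric_frameworks E S"
    and "q $ None = 0"
    and "q \<in> symmetric_frameworks (cone_graph E) (star_mat ` S)"
    and "projects_to q p"
  shows "isomorphic_subspaces
           (symmetric_motions E S p)
           (symmetric_motions (cone_graph E) (star_mat ` S) q \<inter> cone_joint_fixed) \<and>
         isomorphic_subspaces
           (symmetric_trivial_motions E S p)
           (symmetric_trivial_motions (cone_graph E) (star_mat ` S) q \<inter> cone_joint_fixed) \<and>
         ((\<exists>u. u \<in> symmetric_motions E S p \<and> u \<notin> trivial_motions E p) \<longleftrightarrow>
          (\<exists>u. u \<in> symmetric_motions (cone_graph E) (star_mat ` S) q \<and>
               u \<notin> trivial_motions (cone_graph E) q)) \<and>
         isomorphic_subspaces
           (symmetric_self_stresses E S p)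
           (symmetric_self_stresses (cone_graph E) (star_mat ` S) q)"
proof -
  interpret coned_framework E S p q
    by unfold_locales (fact assms)+
  show ?thesis
    by (intro conjI isomorphic_symmetric_motions isomorphic_symmetric_trivial_motions
        nontrivial_symmetric_motion_iff isomorphic_symmetric_self_stresses)
qed

end
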